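(* Let $S$ and $\rho$ be time-independent one-body fields giving the wavefunction $\Psi=\sqrt\rho\,e^{iS/\hbar}$ and a smooth, steady quantum flow $\mathcal F(P,\rho_m,\mathbf u,\mathbf v)$; $\Psi$ is not necessarily an eigenvector of the Hamiltonian $\hat H=-\frac{\hbar^2}{2m}\nabla^2+U$ with external potential $U$. Let $\mathcal C$ be the set of all smooth cross flows $\mathcal F_\times(P,\rho_m,\boldsymbol\mu,\mathbf v)$ of $\mathcal F$ that satisfy $$\rho_m\mathcal D\boldsymbol\omega+\nabla P+\rho\nabla U=\rho\vec F,\qquad \boldsymbol\omega=\boldsymbol\mu+\mathbf v, \tag{$*$}$$ for some nowork force $\vec F$ (which may depend on the cross flow). If $\mathcal C$ is nonempty, the following hold. 1) The flow $\mathcal F$ and every $\mathcal F_\times\in\mathcal C$ satisfy the energy equation $$E\rho=\tfrac12\rho_m|\mathbf u|^2+\tfrac12\rho_m|\mathbf v|^2+P+U\rho$$ (with $|\boldsymbol\mu|^2$ in place of $|\mathbf u|^2$ for $\mathcal F_\times$), where the energy scalar field $E$ is constant on each streamline of $\mathcal F_\times$ but may depend on the streamline. 2) If $\mathcal F$ satisfies the continuity equation $\partial\rho+\nabla\cdot(\rho\mathbf v)=0$, then the following are equivalent: (a) $\Psi$ is an eigenvector of the time-independent Schr\"odinger equation, $\hat H\Psi=E\Psi$; (b) the energy scalar field $E$ is uniform. 3) Equation $( * )$ is an Euler equation for the cross flows $\mathcal F_\times\in\mathcal C$, having the proper momentum time derivative (that is, its term $\rho_m\mathcal D\boldsymbol\omega$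 equals the momentum time derivative density $\rho_m\mathcal D\boldsymbol\omega+\nabla\cdot(\rho_m\boldsymbol\omega)\,\boldsymbol\omega$ of a steady, variable-mass flow), if and only if mass is conserved ($\nabla\cdot(\rho_m\boldsymbol\omega)=0$).
   Context: Constants $\hbar,m>0$; $\nabla$ is the gradient in $\mathbb R^3$. A one-body quantum flow is determined by real functions $\rho\ge0$ (zero set of measure zero) and $S$, via $\rho_m=m\rho$, $\mathbf v=\frac1m\nabla S$, $\mathbf u=-\frac{\hbar}{2m}\frac{\nabla\rho}{\rho}$, $P=\frac\hbar2\nabla\cdot(\rho\mathbf u)$. It is smooth if $\nabla\rho\cdot\nabla S=0$ (equivalently $\mathbf u\cdot\mathbf v=0$) and steady if $\partial\rho/\partial t=0$. A cross flow of $\mathcal F$ is given by a vector field $\boldsymbol\mu$ with $\boldsymbol\mu\cdot\mathbf u=0$ and $|\boldsymbol\mu|=|\mathbf u|$, with the same $P,\rho_m,\mathbf v$; its velocity field is $\boldsymbol\omega=\boldsymbol\mu+\mathbf v$, its streamlines are the integral curves of $\boldsymbol\omega$, and it is called smooth if $\mathcal F$ is. $\mathcal D\boldsymbol\omega=(\boldsymbol\omega\cdot\nabla)\boldsymbol\omega$ is the material derivative of the steady field $\boldsymbol\omega$. A nowork force is a vector field $\vec F$ with $\vec F\cdot\boldsymbol\omega=0$. $U$ is a real-valued potential. Equalities are understood almost everywhere.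
   Formalization: In part 1, the constancy of E on each streamline of a cross flow is claimed only for cross flows with μ·v = 0 almost everywhere; without this it can fail, since ( * ) gives only that E + m μ·v is constant on streamlines. *)

theory Defs
  imports "HOL-Analysis.Analysis"
begin

section \<open>Vector calculus on three-dimensional space\<close>

definition partial_deriv :: "3 \<Rightarrow> (real^3 \<Rightarrow> 'b::real_normed_vector) \<Rightarrow> real^3 \<Rightarrow> 'b" where
  "partial_deriv i f x = frechet_derivative f (at x) (axis i 1)"

text \<open>Class \<open>C^k\<close>; meant for open \<open>A\<close>, where it is the usual notion.\<close>

primrec Ck_on :: "nat \<Rightarrow> (real^3 \<Rightarrow> 'b::real_normed_vector) \<Rightarrow> (real^3) set \<Rightarrow> bool" where
  "Ck_on 0 f A \<longleftrightarrow> continuous_on A f"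
| "Ck_on (Suc k) f A \<longleftrightarrow> f differentiable_on A \<and> (\<forall>i. Ck_on k (partial_deriv i f) A)"

definition grad :: "(real^3 \<Rightarrow> real) \<Rightarrow> real^3 \<Rightarrow> real^3" where
  "grad f x = (\<chi> i. partial_deriv i f x)"

definition divergence :: "(real^3 \<Rightarrow> real^3) \<Rightarrow> real^3 \<Rightarrow> real" where
  "divergence w x = (\<Sum>i\<in>UNIV. partial_deriv i (\<lambda>y. w y $ i) x)"

definition laplacian :: "(real^3 \<Rightarrow> 'b::real_normed_vector) \<Rightarrow> real^3 \<Rightarrow> 'b" where
  "laplacian f x = (\<Sum>i\<in>UNIV. partial_deriv i (partial_deriv i f) x)"

text \<open>\<open>(w \<cdot> \<nabla>) w\<close>, the material derivative of a steady velocity field.\<close>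

definition material_deriv :: "(real^3 \<Rightarrow> real^3) \<Rightarrow> real^3 \<Rightarrow> real^3" where
  "material_deriv w x = (\<Sum>i\<in>UNIV. (w x $ i) *\<^sub>R partial_deriv i w x)"

section \<open>Quantum flows\<close>

text \<open>All fields are time-independent, i.e. functions of position only, so every flow is steady and
  the time derivative in the continuity equation vanishes. Parameters: \<open>\<hbar>\<close> is written \<open>hbar\<close>,
  \<open>m\<close> is the mass, \<open>\<rho>\<close> the density, \<open>S\<close> the phase function and \<open>U\<close> the potential.\<close>

definition mass_density :: "real \<Rightarrow> (real^3 \<Rightarrow> real) \<Rightarrow> real^3 \<Rightarrow> real" where
  "mass_density m \<rho> x = m * \<rho> x"

definition vel_v :: "real \<Rightarrow> (real^3 \<Rightarrow> real) \<Rightarrow> real^3 \<Rightarrow> real^3" where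
  "vel_v m S x = (1 / m) *\<^sub>R grad S x"

definition vel_u :: "real \<Rightarrow> real \<Rightarrow> (real^3 \<Rightarrow> real) \<Rightarrow> real^3 \<Rightarrow> real^3" where
  "vel_u hbar m \<rho> x = (- (hbar / (2 * m))) *\<^sub>R ((1 / \<rho> x) *\<^sub>R grad \<rho> x)"

definition pressure :: "real \<Rightarrow> real \<Rightarrow> (real^3 \<Rightarrow> real) \<Rightarrow> real^3 \<Rightarrow> real" where
  "pressure hbar m \<rho> x = (hbar / 2) * divergence (\<lambda>y. \<rho> y *\<^sub>R vel_u hbar m \<rho> y) x"

text \<open>``Smooth'' is not a regularity condition here: it is orthogonality of the gradients.\<close>

definition smooth_flow :: "(real^3 \<Rightarrow> real) \<Rightarrow> (real^3 \<Rightarrow> real) \<Rightarrow> bool" where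
  "smooth_flow \<rho> S \<longleftrightarrow> (AE x in lebesgue. grad \<rho> x \<bullet> grad S x = 0)"

definition continuity_equation :: "real \<Rightarrow> (real^3 \<Rightarrow> real) \<Rightarrow> (real^3 \<Rightarrow> real) \<Rightarrow> bool" where
  "continuity_equation m \<rho> S \<longleftrightarrow>
     (AE x in lebesgue. divergence (\<lambda>y. \<rho> y *\<^sub>R vel_v m S y) x = 0)"

section \<open>Schroedinger operator\<close>

definition wavefunction :: "real \<Rightarrow> (real^3 \<Rightarrow> real) \<Rightarrow> (real^3 \<Rightarrow> real) \<Rightarrow> real^3 \<Rightarrow> complex" where
  "wavefunction hbar \<rho> S x = of_real (sqrt (\<rho> x)) * exp (\<i> * of_real (S x / hbar))"

definition hamiltonian ::
  "real \<Rightarrow> real \<Rightarrow> (real^3 \<Rightarrow> real) \<Rightarrow> (real^3 \<Rightarrow> complex) \<Rightarrow> real^3 \<Rightarrow> complex" where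
  "hamiltonian hbar m U \<psi> x =
     - of_real (hbar\<^sup>2 / (2 * m)) * laplacian \<psi> x + of_real (U x) * \<psi> x"

definition eigenpair :: "((real^3 \<Rightarrow> complex) \<Rightarrow> real^3 \<Rightarrow> complex) \<Rightarrow> complex \<Rightarrow> (real^3 \<Rightarrow> complex) \<Rightarrow> bool" where
  "eigenpair H e \<psi> \<longleftrightarrow>
     \<not> (AE x in lebesgue. \<psi> x = 0) \<and> (AE x in lebesgue. H \<psi> x = e * \<psi> x)"

section \<open>Cross flows\<close>

text \<open>A cross flow shares \<open>P\<close>, \<open>\<rho>\<^sub>m\<close> and \<open>v\<close> with the given flow, so it is represented by its field
  \<open>\<mu>\<close> alone. The open set \<open>\<Omega>\<close> is the region where the fields have the derivatives that
  occur; it is going to have negligible complement (which may contain nodes, cusps of the density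
  and singularities of the potential).\<close>

definition cross_flow ::
  "(real^3) set \<Rightarrow> real \<Rightarrow> real \<Rightarrow> (real^3 \<Rightarrow> real) \<Rightarrow> (real^3 \<Rightarrow> real^3) \<Rightarrow> bool" where
  "cross_flow \<Omega> hbar m \<rho> \<mu> \<longleftrightarrow>
     Ck_on 1 \<mu> \<Omega> \<and>
     (AE x in lebesgue. \<mu> x \<bullet> vel_u hbar m \<rho> x = 0) \<and>
     (AE x in lebesgue. norm (\<mu> x) = norm (vel_u hbar m \<rho> x))"

definition cross_vel :: "real \<Rightarrow> (real^3 \<Rightarrow> real) \<Rightarrow> (real^3 \<Rightarrow> real^3) \<Rightarrow> real^3 \<Rightarrow> real^3" where
  "cross_vel m S \<mu> x = \<mu> x + vel_v m S x"

definition nowork_force :: "(real^3 \<Rightarrow> real^3) \<Rightarrow> (real^3 \<Rightarrow> real^3) \<Rightarrow> bool" where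
  "nowork_force w F \<longleftrightarrow> (AE x in lebesgue. F x \<bullet> w x = 0)"

definition momentum_equation ::
  "real \<Rightarrow> real \<Rightarrow> (real^3 \<Rightarrow> real) \<Rightarrow> (real^3 \<Rightarrow> real) \<Rightarrow> (real^3 \<Rightarrow> real^3) \<Rightarrow> (real^3 \<Rightarrow> real^3) \<Rightarrow> bool" where
  "momentum_equation hbar m \<rho> U w F \<longleftrightarrow>
     (AE x in lebesgue. mass_density m \<rho> x *\<^sub>R material_deriv w x
        + grad (pressure hbar m \<rho>) x + \<rho> x *\<^sub>R grad U x = \<rho> x *\<^sub>R F x)"

definition nowork_cross_flows ::
  "(real^3) set \<Rightarrow> real \<Rightarrow> real \<Rightarrow> (real^3 \<Rightarrow> real) \<Rightarrow> (real^3 \<Rightarrow> real) \<Rightarrow> (real^3 \<Rightarrow> real)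
     \<Rightarrow> (real^3 \<Rightarrow> real^3) set" where
  "nowork_cross_flows \<Omega> hbar m \<rho> S U =
     {\<mu>. cross_flow \<Omega> hbar m \<rho> \<mu> \<and> smooth_flow \<rho> S \<and>
         (\<exists>F. nowork_force (cross_vel m S \<mu>) F \<and>
              momentum_equation hbar m \<rho> U (cross_vel m S \<mu>) F)}"

text \<open>\<open>\<gamma>\<close>, on the interval \<open>I\<close>, is an integral curve of \<open>w\<close> within \<open>\<Omega>\<close>.\<close>

definition streamline ::
  "(real^3) set \<Rightarrow> (real^3 \<Rightarrow> real^3) \<Rightarrow> (real \<Rightarrow> real^3) \<Rightarrow> real set \<Rightarrow> bool" where
  "streamline \<Omega> w \<gamma> I \<longleftrightarrow>
     is_interval I \<and> \<gamma> ` I \<subseteq> \<Omega> \<and>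
     (\<forall>t\<in>I. (\<gamma> has_vector_derivative w (\<gamma> t)) (at t within I))"

text \<open>The right-hand side of the energy equation for the velocity pair \<open>(a, v)\<close>, where \<open>a\<close> is
  \<open>u\<close> for the flow itself and \<open>\<mu>\<close> for a cross flow.\<close>

definition energy_density ::
  "real \<Rightarrow> real \<Rightarrow> (real^3 \<Rightarrow> real) \<Rightarrow> (real^3 \<Rightarrow> real) \<Rightarrow> (real^3 \<Rightarrow> real) \<Rightarrow> (real^3 \<Rightarrow> real^3)
     \<Rightarrow> real^3 \<Rightarrow> real" where
  "energy_density hbar m \<rho> S U a x =
     1/2 * mass_density m \<rho> x * (norm (a x))\<^sup>2
     + 1/2 * mass_density m \<rho> x * (norm (vel_v m S x))\<^sup>2
     + pressure hbar m \<rho> x + U x * \<rho> x"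

definition mass_flux_divergence :: "real \<Rightarrow> (real^3 \<Rightarrow> real) \<Rightarrow> (real^3 \<Rightarrow> real^3) \<Rightarrow> real^3 \<Rightarrow> real" where
  "mass_flux_divergence m \<rho> w x = divergence (\<lambda>y. mass_density m \<rho> y *\<^sub>R w y) x"

text \<open>Momentum time derivative density of a steady flow of variable mass.\<close>

definition momentum_time_deriv ::
  "real \<Rightarrow> (real^3 \<Rightarrow> real) \<Rightarrow> (real^3 \<Rightarrow> real^3) \<Rightarrow> real^3 \<Rightarrow> real^3" where
  "momentum_time_deriv m \<rho> w x =
     mass_density m \<rho> x *\<^sub>R material_deriv w x + mass_flux_divergence m \<rho> w x *\<^sub>R w x"

end

theory Submission
  imports Defs
begin

text \<open>The energy field is \<open>E = m/2 (|u|\<^sup>2 + |v|\<^sup>2) + P/\<rho> + U\<close>. All fields involved are continuous on the open set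
  \<open>\<Omega>\<close>, so identities that hold almost everywhere hold at every point of \<open>\<Omega>\<close>, in particular along every
  streamline. There \<open>E = m/2 |\<omega>|\<^sup>2 + P/\<rho> + U\<close> because \<open>\<mu>\<close> is orthogonal to \<open>v\<close>; the momentum equation
  multiplied by \<open>\<omega>\<close> and \<open>\<omega> \<cdot> \<nabla>\<rho> = 0\<close> then give \<open>\<omega> \<cdot> \<nabla>E = 0\<close>.
  For the eigenvalue problem, \<open>\<partial>\<^sub>i\<psi> = \<psi> (\<partial>\<^sub>i\<rho> / (2\<rho>) + \<i> \<partial>\<^sub>iS / \<hbar>)\<close>; differentiating once more, the real part
  produces \<open>E\<close> while the imaginary part vanishes by smoothness and continuity, so that \<open>H \<psi> = E \<psi>\<close>
  almost everywhere, with \<open>\<psi> \<noteq> 0\<close> on \<open>\<Omega>\<close>.\<close>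

section \<open>From almost everywhere to everywhere on open sets\<close>

lemma AE_lebesgue_iff_negligible:
  "(AE x in lebesgue. P x) \<longleftrightarrow> negligible {x. \<not> P (x :: 'a::euclidean_space)}"
proof
  assume "AE x in lebesgue. P x"
  then obtain N where "{x. \<not> P x} \<subseteq> N" "N \<in> null_sets lebesgue"
    by (auto simp: eventually_ae_filter)
  then show "negligible {x. \<not> P x}"
    by (meson negligible_iff_null_sets negligible_subset)
next
  assume "negligible {x. \<not> P x}"
  then show "AE x in lebesgue. P x"
    by (intro AE_I'[of "{x. \<not> P x}"]) (auto simp: negligible_iff_null_sets)
qed

text \<open>A disagreement at one point would spread to a nonempty open set, which is not
  negligible. This makes almost-everywhere hypotheses usable along streamlines, which may themselves
  be null sets.\<close>

lemma AE_eq_continuous_imp_eq: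
  fixes f g :: "'a::euclidean_space \<Rightarrow> 'b::real_normed_vector"
  assumes "open A" "continuous_on A f" "continuous_on A g" "AE x in lebesgue. f x = g x" "x \<in> A"
  shows "f x = g x"
proof (rule ccontr)
  assume "f x \<noteq> g x"
  have "open (A \<inter> (\<lambda>x. f x - g x) -` (- {0}))"
    using assms(1-3) by (intro continuous_open_preimage continuous_on_diff open_Compl) auto
  moreover have "x \<in> A \<inter> (\<lambda>x. f x - g x) -` (- {0})"
    using assms \<open>f x \<noteq> g x\<close> by auto
  ultimately have "\<not> negligible (A \<inter> (\<lambda>x. f x - g x) -` (- {0}))"
    using open_not_negligible by blast
  moreover have "negligible {x. f x \<noteq> g x}"
    using assms(4) by (simp add: AE_lebesgue_iff_negligible)
  moreover have "A \<inter> (\<lambda>x. f x - g x) -` (- {0}) \<subseteq> {x. f x \<noteq> g x}"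
    by auto
  ultimately show False
    using negligible_subset by blast
qed

section \<open>Partial derivatives\<close>

lemma partial_deriv_eqI:
  "(f has_derivative f') (at x) \<Longrightarrow> partial_deriv i f x = f' (axis i 1)"
  unfolding partial_deriv_def by (metis frechet_derivative_at)

lemma differentiable_on_openD:
  "f differentiable_on A \<Longrightarrow> open A \<Longrightarrow> x \<in> A \<Longrightarrow> f differentiable (at x)"
  by (simp add: differentiable_on_eq_differentiable_at)

lemma has_derivative_cong_open:
  assumes "open A" "x \<in> A" "\<And>y. y \<in> A \<Longrightarrow> f y = g y"
  shows "(f has_derivative D) (at x) \<longleftrightarrow> (g has_derivative D) (at x)"
  using assms by (metis has_derivative_transform_within_open)

text \<open>Both functions have exactly the same derivatives at \<open>x\<close>, so the choice
  inside \<open>frechet_derivative\<close> returns the same value even where no derivative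
  exists.\<close>

lemma partial_deriv_cong_open:
  assumes "open A" "x \<in> A" "\<And>y. y \<in> A \<Longrightarrow> f y = g y"
  shows "partial_deriv i f x = partial_deriv i g x"
  unfolding partial_deriv_def frechet_derivative_def
  using has_derivative_cong_open[OF assms] by simp

lemma partial_deriv_bounded_linear:
  assumes "bounded_linear L" "f differentiable (at x)"
  shows "partial_deriv i (\<lambda>y. L (f y)) x = L (partial_deriv i f x)"
proof -
  obtain D where D: "(f has_derivative D) (at x)"
    using assms(2) by (auto simp: differentiable_def)
  show ?thesis
    using partial_deriv_eqI[OF bounded_linear.has_derivative[OF assms(1) D]] partial_deriv_eqI[OF D]
    by simp
qed

lemma partial_deriv_add:
  assumes "f differentiable (at x)" "g differentiable (at x)"
  shows "partial_deriv i (\<lambda>y. f y + g y) x = partial_deriv i f x + partial_deriv i g x"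
proof -
  obtain D D' where D: "(f has_derivative D) (at x)" "(g has_derivative D') (at x)"
    using assms by (auto simp: differentiable_def)
  show ?thesis
    using partial_deriv_eqI[OF has_derivative_add[OF D]] partial_deriv_eqI[OF D(1)]
      partial_deriv_eqI[OF D(2)] by simp
qed

lemma partial_deriv_bilinear:
  assumes "bounded_bilinear B" "f differentiable (at x)" "g differentiable (at x)"
  shows "partial_deriv i (\<lambda>y. B (f y) (g y)) x
    = B (f x) (partial_deriv i g x) + B (partial_deriv i f x) (g x)"
proof -
  obtain D D' where D: "(f has_derivative D) (at x)" "(g has_derivative D') (at x)"
    using assms by (auto simp: differentiable_def)
  show ?thesis
    using partial_deriv_eqI[OF bounded_bilinear.FDERIV[OF assms(1) D]] partial_deriv_eqI[OF D(1)]
      partial_deriv_eqI[OF D(2)] by simp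
qed

lemmas partial_deriv_mult = partial_deriv_bilinear[OF bounded_bilinear_mult]

lemma partial_deriv_of_real:
  assumes "f differentiable (at x)"
  shows "partial_deriv i (\<lambda>y. complex_of_real (f y)) x = of_real (partial_deriv i f x)"
  by (rule partial_deriv_bounded_linear[OF bounded_linear_of_real assms])

lemma linear_eq_sum_axis:
  fixes L :: "real^'n \<Rightarrow> 'b::real_vector"
  assumes "linear L"
  shows "L h = (\<Sum>i\<in>UNIV. (h $ i) *\<^sub>R L (axis i 1))"
proof -
  have "h = (\<Sum>i\<in>UNIV. (h $ i) *\<^sub>R axis i 1)"
    using basis_expansion[of h] by (simp add: scalar_mult_eq_scaleR)
  then have "L h = L (\<Sum>i\<in>UNIV. (h $ i) *\<^sub>R axis i 1)"
    by simp
  also have "\<dots> = (\<Sum>i\<in>UNIV. (h $ i) *\<^sub>R L (axis i 1))"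
    using assms by (simp add: linear_sum linear_cmul)
  finally show ?thesis .
qed

lemma has_derivative_grad:
  assumes "f differentiable (at x)"
  shows "(f has_derivative (\<lambda>h. grad f x \<bullet> h)) (at x)"
proof -
  obtain D where D: "(f has_derivative D) (at x)"
    using assms by (auto simp: differentiable_def)
  have "D h = grad f x \<bullet> h" for h
    by (subst linear_eq_sum_axis[OF has_derivative_linear[OF D]])
      (simp add: grad_def inner_vec_def partial_deriv_eqI[OF D] mult.commute)
  then show ?thesis
    using D by presburger
qed

text \<open>By linearity the sum over the axes is the directional derivative along
  \<open>w x\<close>, the form in which the chain rule produces it in Bernoulli's argument.\<close>

lemma material_deriv_eq:
  assumes "(w has_derivative W) (at x)"
  shows "material_deriv w x = W (w x)"
  unfolding material_deriv_def
  by (simp add: linear_eq_sum_axis[OF has_derivative_linear[OF assms], of "w x"]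
      partial_deriv_eqI[OF assms])

section \<open>Closure properties of the classes of differentiable functions\<close>

lemma Ck_on_cong:
  assumes "open A" "\<And>x. x \<in> A \<Longrightarrow> f x = g x"
  shows "Ck_on k f A \<longleftrightarrow> Ck_on k g A"
  using assms(2)
proof (induction k arbitrary: f g)
  case 0
  then show ?case by (simp cong: continuous_on_cong)
next
  case (Suc k)
  have "f differentiable_on A \<longleftrightarrow> g differentiable_on A"
    using Suc.prems by (metis differentiable_on_def differentiable_transform_within zero_less_one)
  moreover have "Ck_on k (partial_deriv i f) A \<longleftrightarrow> Ck_on k (partial_deriv i g) A" for i
    by (rule Suc.IH) (rule partial_deriv_cong_open[OF assms(1)], use Suc.prems in auto)
  ultimately show ?case by simp
qed

lemma Ck_on_imp_continuous_on: "Ck_on k f A \<Longrightarrow> continuous_on A f"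
  by (cases k) (auto intro: differentiable_imp_continuous_on)

text \<open>The recursion asks for continuity only at the last order; the base case is that
  differentiability implies continuity.\<close>

lemma Ck_on_SucD: "Ck_on (Suc k) f A \<Longrightarrow> Ck_on k f A"
proof (induction k arbitrary: f)
  case 0
  then show ?case using Ck_on_imp_continuous_on by fastforce
next
  case (Suc k)
  then show ?case by (metis Ck_on.simps(2))
qed

lemma Ck_on_Suc_differentiable:
  "Ck_on (Suc k) f A \<Longrightarrow> open A \<Longrightarrow> x \<in> A \<Longrightarrow> f differentiable (at x)"
  using differentiable_on_openD by auto

lemma Ck_on_zero: "Ck_on k (\<lambda>x. 0) A"
proof (induction k)
  case (Suc k)
  have "partial_deriv i (\<lambda>x. 0 :: 'a) = (\<lambda>x. 0)" for i
    by (rule ext) (simp add: partial_deriv_eqI[OF has_derivative_const])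
  then show ?case using Suc by simp
qed simp

text \<open>The sum rule is available only at points of \<open>A\<close>, where both summands are
  differentiable, so partial derivatives are exchanged through \<open>Ck_on_cong\<close>. The linear
  and bilinear lemmas below follow the same scheme.\<close>

lemma Ck_on_add:
  assumes "open A" "Ck_on k f A" "Ck_on k g A"
  shows "Ck_on k (\<lambda>x. f x + g x) A"
  using assms(2,3)
proof (induction k arbitrary: f g)
  case (Suc k)
  have "Ck_on k (partial_deriv i (\<lambda>x. f x + g x)) A" for i
  proof -
    have "Ck_on k (\<lambda>x. partial_deriv i f x + partial_deriv i g x) A"
      using Suc by simp
    then show ?thesis
      by (subst Ck_on_cong[OF assms(1)])
        (auto intro!: partial_deriv_add Ck_on_Suc_differentiable[OF _ assms(1)] Suc.prems)
  qed
  then show ?case using Suc.prems by simp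
qed (simp add: continuous_on_add)

lemma Ck_on_sum:
  assumes "open A" "\<And>i. i \<in> I \<Longrightarrow> Ck_on k (f i) A"
  shows "Ck_on k (\<lambda>x. \<Sum>i\<in>I. f i x) A"
  using assms(2)
  by (induction I rule: infinite_finite_induct) (auto intro: Ck_on_add[OF assms(1)] Ck_on_zero)

lemma Ck_on_bounded_linear:
  assumes "open A" "bounded_linear L" "Ck_on k f A"
  shows "Ck_on k (\<lambda>x. L (f x)) A"
  using assms(3)
proof (induction k arbitrary: f)
  case 0
  then show ?case using assms(2) by (simp add: bounded_linear.continuous_on)
next
  case (Suc k)
  have "Ck_on k (partial_deriv i (\<lambda>x. L (f x))) A" for i
  proof -
    have "Ck_on k (\<lambda>x. L (partial_deriv i f x)) A"
      using Suc by simp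
    then show ?thesis
      by (subst Ck_on_cong[OF assms(1)])
        (auto intro!: partial_deriv_bounded_linear[OF assms(2)]
          Ck_on_Suc_differentiable[OF _ assms(1)] Suc.prems)
  qed
  moreover have "(\<lambda>x. L (f x)) differentiable_on A"
    using Suc.prems bounded_linear.has_derivative[OF assms(2)]
    unfolding Ck_on.simps differentiable_on_def differentiable_def by blast
  ultimately show ?case by simp
qed

lemma Ck_on_bilinear:
  assumes "open A" "bounded_bilinear B" "Ck_on k f A" "Ck_on k g A"
  shows "Ck_on k (\<lambda>x. B (f x) (g x)) A"
  using assms(3,4)
proof (induction k arbitrary: f g)
  case 0
  then show ?case using assms(2) by (simp add: bounded_bilinear.continuous_on)
next
  case (Suc k)
  have "Ck_on k (partial_deriv i (\<lambda>x. B (f x) (g x))) A" for i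
  proof -
    have "Ck_on k (\<lambda>x. B (f x) (partial_deriv i g x) + B (partial_deriv i f x) (g x)) A"
      \<comment> \<open>Each term of the product rule keeps one factor undifferentiated, whose order
        has to be lowered to \<open>k\<close> before the induction hypothesis applies.\<close>
      using Suc.prems Suc.prems[THEN Ck_on_SucD] by (intro Ck_on_add[OF assms(1)] Suc.IH) auto
    then show ?thesis
      by (subst Ck_on_cong[OF assms(1)])
        (auto intro!: partial_deriv_bilinear[OF assms(2)]
          Ck_on_Suc_differentiable[OF _ assms(1)] Suc.prems)
  qed
  moreover have "(\<lambda>x. B (f x) (g x)) differentiable_on A"
    using Suc.prems bounded_bilinear.FDERIV[OF assms(2)]
    unfolding Ck_on.simps differentiable_on_def differentiable_def by blast
  ultimately show ?case by simp
qed

lemma Ck_on_grad: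
  assumes "open A" "Ck_on (Suc k) f A"
  shows "Ck_on k (grad f) A"
proof -
  have "grad f = (\<lambda>x. \<Sum>i\<in>UNIV. partial_deriv i f x *\<^sub>R axis i 1)"
    by (auto simp: grad_def vec_eq_iff axis_def if_distrib cong: if_cong)
  moreover have "Ck_on k (\<lambda>x. \<Sum>i\<in>UNIV. partial_deriv i f x *\<^sub>R axis i (1::real)) A"
    using assms
    by (intro Ck_on_sum Ck_on_bounded_linear[OF _ bounded_linear_scaleR_left]) auto
  ultimately show ?thesis by simp
qed

lemma Ck_on_laplacian:
  assumes "open A" "Ck_on (Suc (Suc k)) f A"
  shows "Ck_on k (laplacian f) A"
  unfolding laplacian_def[abs_def] using assms by (intro Ck_on_sum) auto

lemma Ck_on_divergence:
  assumes "open A" "Ck_on (Suc k) w A"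
  shows "Ck_on k (divergence w) A"
proof -
  have "Ck_on (Suc k) (\<lambda>x. w x $ i) A" for i
    by (rule Ck_on_bounded_linear[OF assms(1) bounded_linear_vec_nth assms(2)])
  then show ?thesis
    unfolding divergence_def[abs_def] using assms(1) by (intro Ck_on_sum) auto
qed

lemma continuous_on_material_deriv:
  assumes "Ck_on 1 w A"
  shows "continuous_on A (material_deriv w)"
proof -
  have "continuous_on A w" "\<And>i. continuous_on A (partial_deriv i w)"
    using assms Ck_on_imp_continuous_on[OF assms] by auto
  then show ?thesis
    unfolding material_deriv_def[abs_def] by (intro continuous_intros)
qed

lemma divergence_cong_open:
  assumes "open A" "x \<in> A" "\<And>y. y \<in> A \<Longrightarrow> f y = g y"
  shows "divergence f x = divergence g x"
  unfolding divergence_def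
  by (intro sum.cong refl partial_deriv_cong_open[OF assms(1,2)]) (simp add: assms(3))

text \<open>Serves twice: with constant \<phi> for the pressure, and with \<phi> = \<rho> / m for
  the continuity equation.\<close>

lemma divergence_scaleR_grad:
  assumes "open A" "x \<in> A" "\<phi> differentiable (at x)" "Ck_on 2 f A"
  shows "divergence (\<lambda>y. \<phi> y *\<^sub>R grad f y) x = \<phi> x * laplacian f x + grad \<phi> x \<bullet> grad f x"
proof -
  have "Ck_on (Suc 0) (partial_deriv i f) A" for i
    using assms(4) by (simp add: numeral_2_eq_2)
  then have "partial_deriv i f differentiable (at x)" for i
    using assms(1,2) Ck_on_Suc_differentiable by blast
  then have "partial_deriv i (\<lambda>y. \<phi> y * partial_deriv i f y) x
     = \<phi> x * partial_deriv i (partial_deriv i f) x + partial_deriv i \<phi> x * partial_deriv i f x" for i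
    using assms(3) by (intro partial_deriv_mult)
  then show ?thesis
    by (simp add: divergence_def grad_def laplacian_def inner_vec_def sum.distrib sum_distrib_left)
qed

section \<open>The energy equation\<close>

text \<open>The density cancels in \<rho> u, leaving a constant multiple of the gradient of
  \<rho>.\<close>

lemma pressure_eq_laplacian:
  assumes "open A" "x \<in> A" "Ck_on 2 \<rho> A" "\<forall>x\<in>A. \<rho> x > 0"
  shows "pressure hbar m \<rho> x = - (hbar\<^sup>2 / (4 * m)) * laplacian \<rho> x"
proof -
  have "divergence (\<lambda>y. \<rho> y *\<^sub>R vel_u hbar m \<rho> y) x = divergence (\<lambda>y. (- (hbar / (2*m))) *\<^sub>R grad \<rho> y) x"
    using assms(4) by (intro divergence_cong_open[OF assms(1,2)]) (auto simp: vel_u_def less_le)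
  also have "\<dots> = - (hbar / (2*m)) * laplacian \<rho> x"
    by (subst divergence_scaleR_grad[OF assms(1,2) _ assms(3)])
      (auto simp: grad_def partial_deriv_eqI[OF has_derivative_const] inner_vec_def)
  finally show ?thesis
    by (simp add: pressure_def power2_eq_square)
qed

text \<open>Along \<open>w\<close> the work of \<open>F\<close> vanishes and \<open>\<rho>\<close> is stationary, so the two terms that could spoil
  Bernoulli's argument drop out.\<close>

lemma bernoulli_derivative:
  fixes w F :: "real^3 \<Rightarrow> real^3"
  assumes "open A" "x \<in> A" "\<rho> x > 0"
    and "w differentiable (at x)" "P differentiable (at x)" "\<rho> differentiable (at x)" "U differentiable (at x)"
    and "\<And>y. y \<in> A \<Longrightarrow> E y = m / 2 * (w y \<bullet> w y) + P y / \<rho> y + U y"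
    and "w x \<bullet> ((m * \<rho> x) *\<^sub>R material_deriv w x + grad P x + \<rho> x *\<^sub>R grad U x) = 0"
    and "grad \<rho> x \<bullet> w x = 0"
  shows "\<exists>D. (E has_derivative D) (at x) \<and> D (w x) = 0"
proof -
  obtain W where W: "(w has_derivative W) (at x)"
    using assms(4) by (auto simp: differentiable_def)
  note G = has_derivative_grad[OF assms(5)] has_derivative_grad[OF assms(6)] has_derivative_grad[OF assms(7)]
  \<comment> \<open>The derivative of the Bernoulli expression, written in the shape that
    \<open>has_derivative_divide\<close> yields for the quotient.\<close>
  define D where "D = (\<lambda>h. m / 2 * (w x \<bullet> W h + W h \<bullet> w x)
    + (- P x * (inverse (\<rho> x) * (grad \<rho> x \<bullet> h) * inverse (\<rho> x)) + (grad P x \<bullet> h) / \<rho> x) + grad U x \<bullet> h)"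
  have "((\<lambda>y. m / 2 * (w y \<bullet> w y) + P y / \<rho> y + U y) has_derivative D) (at x)"
    unfolding D_def using assms(3)
    by (intro has_derivative_add has_derivative_mult_right has_derivative_inner has_derivative_divide W G) auto
  then have "(E has_derivative D) (at x)"
    using has_derivative_cong_open[OF assms(1,2,8), where D = D] by simp
  \<comment> \<open>Multiplication by \<open>\<rho> x\<close> clears denominators and leaves the
    assumed work identity, the quotient-rule term in \<open>grad \<rho> x\<close> being zero along
    \<open>w x\<close>.\<close>
  moreover have "\<rho> x * D (w x) = 0"
  proof -
    have "\<rho> x * D (w x) = w x \<bullet> ((m * \<rho> x) *\<^sub>R W (w x) + grad P x + \<rho> x *\<^sub>R grad U x)"
      using assms(3,10) unfolding D_def
      by (simp add: algebra_simps inner_commute[of _ "w x"])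
    then show ?thesis
      using assms(9) material_deriv_eq[OF W] by simp
  qed
  then have "D (w x) = 0"
    using assms(3) by simp
  ultimately show ?thesis by blast
qed

text \<open>By the chain rule the derivative of E along \<gamma> is \<open>D\<close> at a multiple
  of \<open>w (\<gamma> t)\<close>, hence 0. Derivatives within \<open>I\<close> cover endpoints,
  and convexity of the interval turns zero derivative into constancy.\<close>

lemma constant_on_streamline:
  assumes "streamline A w \<gamma> I"
    and "\<And>x. x \<in> A \<Longrightarrow> \<exists>D. (E has_derivative D) (at x) \<and> D (w x) = (0::real)"
  shows "E constant_on (\<gamma> ` I)"
proof -
  have I: "convex I"
    using assms(1) by (simp add: streamline_def is_interval_convex)
  have "((\<lambda>t. E (\<gamma> t)) has_derivative (\<lambda>h. 0)) (at t within I)" if t: "t \<in> I" for t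
  proof -
    have \<gamma>: "(\<gamma> has_derivative (\<lambda>h. h *\<^sub>R w (\<gamma> t))) (at t within I)" "\<gamma> t \<in> A"
      using assms(1) t by (auto simp: streamline_def has_vector_derivative_def)
    obtain D where D: "(E has_derivative D) (at (\<gamma> t))" "D (w (\<gamma> t)) = 0"
      using assms(2) \<gamma>(2) by blast
    have "((\<lambda>t. E (\<gamma> t)) has_derivative (\<lambda>h. D (h *\<^sub>R w (\<gamma> t)))) (at t within I)"
      using has_derivative_compose[OF \<gamma>(1) D(1)] .
    moreover have "D (h *\<^sub>R w (\<gamma> t)) = 0" for h
      using D has_derivative_linear linear_cmul by fastforce
    ultimately show ?thesis by simp
  qed
  then obtain c where "\<forall>t\<in>I. E (\<gamma> t) = c"
    using has_derivative_zero_constant[OF I] by blast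
  then show ?thesis
    by (auto simp: constant_on_def)
qed

section \<open>The Schroedinger equation\<close>

text \<open>The logarithmic derivative: keeping \<psi> as an overall factor lets it be divided out
  of the eigenvalue equation later.\<close>

lemma partial_deriv_wavefunction:
  assumes "\<rho> differentiable (at x)" "S differentiable (at x)" "\<rho> x > 0"
  shows "wavefunction hbar \<rho> S differentiable (at x)"
    and "partial_deriv i (wavefunction hbar \<rho> S) x = wavefunction hbar \<rho> S x *
      (of_real (partial_deriv i \<rho> x / (2 * \<rho> x)) + \<i> * of_real (partial_deriv i S x / hbar))"
proof -
  let ?z = "\<lambda>y. \<i> * complex_of_real (S y / hbar)"
  obtain R where R: "(\<rho> has_derivative R) (at x)"
    using assms(1) by (auto simp: differentiable_def)
  obtain T where T: "(S has_derivative T) (at x)"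
    using assms(2) by (auto simp: differentiable_def)
  have z: "(?z has_derivative (\<lambda>h. \<i> * of_real (T h / hbar))) (at x)"
    by (auto intro!: derivative_eq_intros T simp: divide_inverse)
  have e: "((\<lambda>y. exp (?z y)) has_derivative (\<lambda>h. (\<i> * of_real (T h / hbar)) * exp (?z x))) (at x)"
    using has_derivative_compose[OF z, of exp "\<lambda>h. h * exp (?z x)"] DERIV_exp[of "?z x"]
    by (simp add: has_field_derivative_def mult_commute_abs)
  have s: "((\<lambda>y. sqrt (\<rho> y)) has_derivative (\<lambda>h. R h / (2 * sqrt (\<rho> x)))) (at x)"
    using assms(3) by (auto intro!: derivative_eq_intros R simp: field_simps)
  have D: "(wavefunction hbar \<rho> S has_derivative
      (\<lambda>h. of_real (sqrt (\<rho> x)) * ((\<i> * of_real (T h / hbar)) * exp (?z x))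
         + of_real (R h / (2 * sqrt (\<rho> x))) * exp (?z x))) (at x)"
    unfolding wavefunction_def[abs_def]
    by (intro has_derivative_mult e bounded_linear.has_derivative[OF bounded_linear_of_real] s)
  then show "wavefunction hbar \<rho> S differentiable (at x)"
    by (auto simp: differentiable_def)
  \<comment> \<open>Exposes the factor \<open>sqrt (\<rho> x)\<close>, so that both terms of
    \<open>D\<close> are multiples of \<psi>.\<close>
  have "R h / (2 * sqrt (\<rho> x)) = sqrt (\<rho> x) * (R h / (2 * \<rho> x))" for h
    using assms(3) by (simp add: field_simps flip: power2_eq_square)
  then have R': "complex_of_real (R h / (2 * sqrt (\<rho> x))) = of_real (sqrt (\<rho> x)) * of_real (R h / (2 * \<rho> x))" for h
    by (metis of_real_mult)
  show "partial_deriv i (wavefunction hbar \<rho> S) x = wavefunction hbar \<rho> S x *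
      (of_real (partial_deriv i \<rho> x / (2 * \<rho> x)) + \<i> * of_real (partial_deriv i S x / hbar))"
    unfolding partial_deriv_eqI[OF D] partial_deriv_eqI[OF R] partial_deriv_eqI[OF T] R' wavefunction_def
    by (simp only: distrib_left mult_ac add.commute)
qed

text \<open>With \<open>g i\<close> the logarithmic derivative in direction \<open>i\<close>, a
  second differentiation gives \<psi> times the partial derivative of \<open>g i\<close> plus the
  square of \<open>g i\<close>; the statement separates real and imaginary parts.\<close>

lemma laplacian_wavefunction:
  assumes "open A" "x \<in> A" "\<forall>x\<in>A. \<rho> x > 0" "Ck_on 2 \<rho> A" "Ck_on 2 S A" "hbar > 0"
  shows "laplacian (wavefunction hbar \<rho> S) x = wavefunction hbar \<rho> S x *
     (of_real (laplacian \<rho> x / (2 * \<rho> x) - (norm (grad \<rho> x))\<^sup>2 / (4 * (\<rho> x)\<^sup>2)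
         - (norm (grad S x))\<^sup>2 / hbar\<^sup>2)
      + \<i> * of_real ((grad \<rho> x \<bullet> grad S x) / (\<rho> x * hbar) + laplacian S x / hbar))"
proof -
  let ?\<psi> = "wavefunction hbar \<rho> S"
  define a where "a i y = partial_deriv i \<rho> y / (2 * \<rho> y)" for i y
  define b where "b i y = partial_deriv i S y / hbar" for i y
  define g where "g i y = complex_of_real (a i y) + \<i> * of_real (b i y)" for i y
  have d\<rho>: "\<rho> differentiable (at y)" and dS: "S differentiable (at y)"
    and d\<rho>': "partial_deriv i \<rho> differentiable (at y)" and dS': "partial_deriv i S differentiable (at y)"
    if "y \<in> A" for y i
    using that assms by (auto simp: numeral_2_eq_2 intro: differentiable_on_openD)
  have pos: "\<rho> x > 0"
    using assms by auto
  have \<psi>': "partial_deriv i ?\<psi> y = ?\<psi> y * g i y" if "y \<in> A" for i y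
    using partial_deriv_wavefunction(2)[OF d\<rho>[OF that] dS[OF that]] assms(3) that
    unfolding g_def a_def b_def by blast
  have ofr: "(\<lambda>y. complex_of_real (f y)) differentiable (at x)" if "f differentiable (at x)" for f
    using that bounded_linear.has_derivative[OF bounded_linear_of_real]
    unfolding differentiable_def by blast
  have da: "a i differentiable (at x)" for i
    unfolding a_def[abs_def] using pos
    by (intro differentiable_divide differentiable_mult d\<rho>' d\<rho> assms(2) differentiable_const) simp
  have db: "b i differentiable (at x)" for i
    unfolding b_def[abs_def] using assms(6)
    by (intro differentiable_divide dS' assms(2) differentiable_const) simp
  \<comment> \<open>Obtained by differentiating the product \<open>a i y * (2 * \<rho> y)\<close>,
    which is the partial derivative of \<rho>, and solving for the wanted term.\<close>
  have a': "partial_deriv i (a i) x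
      = partial_deriv i (partial_deriv i \<rho>) x / (2 * \<rho> x) - (partial_deriv i \<rho> x)\<^sup>2 / (2 * (\<rho> x)\<^sup>2)" for i
  proof -
    have "partial_deriv i (partial_deriv i \<rho>) x = partial_deriv i (\<lambda>y. a i y * (2 * \<rho> y)) x"
      by (rule partial_deriv_cong_open[OF assms(1,2)]) (use assms(3) in \<open>auto simp: a_def\<close>)
    also have "\<dots> = a i x * (2 * partial_deriv i \<rho> x) + partial_deriv i (a i) x * (2 * \<rho> x)"
      using partial_deriv_mult[OF da] partial_deriv_bounded_linear[OF bounded_linear_mult_right d\<rho>]
        assms(2) d\<rho> by simp
    finally show ?thesis
      using pos by (simp add: a_def field_simps power2_eq_square)
  qed
  have b': "partial_deriv i (b i) x = partial_deriv i (partial_deriv i S) x / hbar" for i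
    unfolding b_def[abs_def]
    by (intro partial_deriv_bounded_linear[OF bounded_linear_divide] dS' assms(2))
  have dib: "(\<lambda>y. \<i> * complex_of_real (b i y)) differentiable (at x)" for i
    by (intro differentiable_mult ofr db differentiable_const)
  have g': "partial_deriv i (g i) x = of_real (partial_deriv i (a i) x) + \<i> * of_real (partial_deriv i (b i) x)" for i
    unfolding g_def[abs_def] partial_deriv_add[OF ofr[OF da] dib]
      partial_deriv_bounded_linear[OF bounded_linear_mult_right ofr[OF db]]
      partial_deriv_of_real[OF da] partial_deriv_of_real[OF db] ..
  have dg: "g i differentiable (at x)" for i
    unfolding g_def[abs_def] by (intro differentiable_add ofr da dib)
  have "partial_deriv i (partial_deriv i ?\<psi>) x = ?\<psi> x *
     (of_real (partial_deriv i (partial_deriv i \<rho>) x / (2 * \<rho> x) - (partial_deriv i \<rho> x)\<^sup>2 / (4 * (\<rho> x)\<^sup>2)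
         - (partial_deriv i S x)\<^sup>2 / hbar\<^sup>2)
      + \<i> * of_real ((partial_deriv i \<rho> x * partial_deriv i S x) / (\<rho> x * hbar) + partial_deriv i (partial_deriv i S) x / hbar))"
    (is "_ = ?\<psi> x * ?c i") for i
  proof -
    have "partial_deriv i (partial_deriv i ?\<psi>) x = partial_deriv i (\<lambda>y. ?\<psi> y * g i y) x"
      by (rule partial_deriv_cong_open[OF assms(1,2) \<psi>'])
    also have "\<dots> = ?\<psi> x * partial_deriv i (g i) x + partial_deriv i ?\<psi> x * g i x"
      by (rule partial_deriv_mult[OF partial_deriv_wavefunction(1)[OF d\<rho> dS pos] dg]) (rule assms)+
    also have "\<dots> = ?\<psi> x * (partial_deriv i (g i) x + g i x * g i x)"
      by (simp add: \<psi>' assms(2) algebra_simps)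
    \<comment> \<open>The square of \<open>a i\<close> changes the coefficient -1/2 of
      \<open>a'\<close> into -1/4, and the cross term \<open>2 * a i x * b i x\<close> gives the
      product of the partial derivatives.\<close>
    also have "partial_deriv i (g i) x + g i x * g i x = ?c i"
      unfolding g' a' b' unfolding g_def a_def b_def using pos assms(6)
      by (simp add: complex_eq_iff power2_eq_square field_simps)
    finally show ?thesis .
  qed
  then have "laplacian ?\<psi> x = ?\<psi> x * (\<Sum>i\<in>UNIV. ?c i)"
    by (simp only: laplacian_def sum_distrib_left)
  moreover have "(norm (grad f x))\<^sup>2 = (\<Sum>i\<in>UNIV. (partial_deriv i f x)\<^sup>2)" for f
    unfolding power2_norm_eq_inner by (simp add: grad_def inner_vec_def power2_eq_square)
  moreover have "grad \<rho> x \<bullet> grad S x = (\<Sum>i\<in>UNIV. partial_deriv i \<rho> x * partial_deriv i S x)"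
    by (simp add: grad_def inner_vec_def)
  ultimately show ?thesis
    by (simp only: laplacian_def sum.distrib sum_subtractf sum_divide_distrib of_real_sum
        of_real_add of_real_diff distrib_left sum_distrib_left)
qed


text \<open>The two orthogonality and continuity conditions remove the imaginary part of the
  Laplacian, and the real part is the energy per density. So \<psi> satisfies the eigenvalue
  equation with a factor that may still depend on position.\<close>

lemma hamiltonian_wavefunction:
  assumes "open A" "x \<in> A" "\<forall>x\<in>A. \<rho> x > 0" "Ck_on 2 \<rho> A" "Ck_on 2 S A" "hbar > 0" "m > 0"
    and "grad \<rho> x \<bullet> grad S x = 0" "divergence (\<lambda>y. \<rho> y *\<^sub>R vel_v m S y) x = 0"
  shows "hamiltonian hbar m U (wavefunction hbar \<rho> S) x
    = of_real (energy_density hbar m \<rho> S U (vel_u hbar m \<rho>) x / \<rho> x) * wavefunction hbar \<rho> S x"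
proof -
  let ?\<psi> = "wavefunction hbar \<rho> S"
  let ?K = "laplacian \<rho> x / (2 * \<rho> x) - (norm (grad \<rho> x))\<^sup>2 / (4 * (\<rho> x)\<^sup>2) - (norm (grad S x))\<^sup>2 / hbar\<^sup>2"
  have pos: "\<rho> x > 0"
    using assms by auto
  have d: "\<rho> differentiable (at x)"
    using assms(1,2,4) Ck_on_Suc_differentiable[of 1] by (simp add: numeral_2_eq_2)
  have "(\<lambda>y. \<rho> y *\<^sub>R vel_v m S y) = (\<lambda>y. (1 / m * \<rho> y) *\<^sub>R grad S y)"
    by (simp add: vel_v_def)
  moreover have "(\<lambda>y. 1 / m * \<rho> y) differentiable (at x)"
    by (intro differentiable_mult d differentiable_const)
  moreover have "grad (\<lambda>y. 1 / m * \<rho> y) x = (1 / m) *\<^sub>R grad \<rho> x"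
    using partial_deriv_bounded_linear[OF bounded_linear_mult_right d, of _ "1 / m"]
    by (simp add: grad_def vec_eq_iff)
  \<comment> \<open>The product rule splits the divergence of \<rho> v into \<rho> / m times this
    Laplacian and a multiple of \<open>grad \<rho> x \<bullet> grad S x\<close>, which is
    zero.\<close>
  ultimately have "laplacian S x = 0"
    using divergence_scaleR_grad[OF assms(1,2) _ assms(5), of "\<lambda>y. 1 / m * \<rho> y"] assms(7-9) pos
    by simp
  then have L: "laplacian ?\<psi> x = ?\<psi> x * of_real ?K"
    using laplacian_wavefunction[OF assms(1-6)] assms(8) by simp
  have "(norm (vel_u hbar m \<rho> x))\<^sup>2 = hbar\<^sup>2 / (4 * m\<^sup>2 * (\<rho> x)\<^sup>2) * (norm (grad \<rho> x))\<^sup>2"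
    by (simp add: vel_u_def power_mult_distrib power_divide)
  moreover have "(norm (vel_v m S x))\<^sup>2 = (norm (grad S x))\<^sup>2 / m\<^sup>2"
    by (simp add: vel_v_def power_mult_distrib power_divide)
  \<comment> \<open>Term by term: pressure matches the Laplacian of \<rho>, the kinetic energy of u
    the squared gradient of \<rho>, and that of v the squared gradient of S.\<close>
  ultimately have E: "energy_density hbar m \<rho> S U (vel_u hbar m \<rho>) x / \<rho> x = - (hbar\<^sup>2 / (2 * m)) * ?K + U x"
    using pos assms(6,7) pressure_eq_laplacian[OF assms(1,2,4,3), of hbar m]
    by (simp only: energy_density_def mass_density_def)
      (simp add: field_simps power2_eq_square)
  show ?thesis
    unfolding hamiltonian_def L E by (simp add: algebra_simps)
qed

text \<open>As \<psi> has no zero on \<open>A\<close>, it cancels from the pointwise equation, and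
  comparing with an eigenvalue \<open>e\<close> leaves only E = \<open>e\<close>.\<close>

lemma eigenpair_wavefunction_iff:
  assumes "open A" "negligible (- A)" "\<forall>x\<in>A. \<rho> x > 0" "Ck_on 2 \<rho> A" "Ck_on 2 S A" "hbar > 0" "m > 0"
    and "smooth_flow \<rho> S" "continuity_equation m \<rho> S"
  shows "eigenpair (hamiltonian hbar m U) e (wavefunction hbar \<rho> S) \<longleftrightarrow>
    (AE x in lebesgue. complex_of_real (energy_density hbar m \<rho> S U (vel_u hbar m \<rho>) x / \<rho> x) = e)"
proof -
  let ?E = "\<lambda>x. complex_of_real (energy_density hbar m \<rho> S U (vel_u hbar m \<rho>) x / \<rho> x)"
  have A: "AE x in lebesgue. x \<in> A"
    using assms(2) by (simp add: AE_lebesgue_iff_negligible Compl_eq)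
  have \<psi>: "wavefunction hbar \<rho> S x \<noteq> 0" if "x \<in> A" for x
    using assms(3) that by (auto simp: wavefunction_def)
  have "\<not> (AE x in lebesgue. wavefunction hbar \<rho> S x = 0)"
  proof
    assume "AE x in lebesgue. wavefunction hbar \<rho> S x = 0"
    with A have "AE x :: real^3 in lebesgue. False"
      by eventually_elim (use \<psi> in auto)
    then show False
      by (simp add: AE_lebesgue_iff_negligible)
  qed
  moreover have "AE x in lebesgue. (hamiltonian hbar m U (wavefunction hbar \<rho> S) x = e * wavefunction hbar \<rho> S x)
      \<longleftrightarrow> ?E x = e"
    using A assms(8,9) unfolding smooth_flow_def continuity_equation_def
  proof eventually_elim
    case (elim x)
    then show ?case
      using hamiltonian_wavefunction[OF assms(1) _ assms(3-7), of x U] \<psi>[of x]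
      by (simp del: of_real_divide)
  qed
  then have "(AE x in lebesgue. hamiltonian hbar m U (wavefunction hbar \<rho> S) x = e * wavefunction hbar \<rho> S x)
      \<longleftrightarrow> (AE x in lebesgue. ?E x = e)"
    by (rule eventually_subst)
  ultimately show ?thesis
    by (simp add: eigenpair_def)
qed

section \<open>Cross flows\<close>

lemma continuous_on_vel_u:
  assumes "open A" "\<forall>x\<in>A. \<rho> x > 0" "Ck_on 1 \<rho> A"
  shows "continuous_on A (vel_u hbar m \<rho>)"
proof -
  have "continuous_on A \<rho>" "continuous_on A (grad \<rho>)"
    using assms Ck_on_grad[of A 0] Ck_on_imp_continuous_on[of 1] by auto
  then show ?thesis
    unfolding vel_u_def[abs_def] using assms(2) by (intro continuous_intros) auto
qed

lemma cross_flow_norm_eq: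
  assumes "open A" "\<forall>x\<in>A. \<rho> x > 0" "Ck_on 1 \<rho> A" "cross_flow A hbar m \<rho> \<mu>" "x \<in> A"
  shows "norm (\<mu> x) = norm (vel_u hbar m \<rho> x)"
proof (rule AE_eq_continuous_imp_eq[OF assms(1) _ _ _ assms(5)])
  show "continuous_on A (\<lambda>x. norm (\<mu> x))" "continuous_on A (\<lambda>x. norm (vel_u hbar m \<rho> x))"
    using assms Ck_on_imp_continuous_on unfolding cross_flow_def
    by (blast intro: continuous_on_norm continuous_on_vel_u)+
  show "AE x in lebesgue. norm (\<mu> x) = norm (vel_u hbar m \<rho> x)"
    using assms(4) by (simp add: cross_flow_def)
qed

lemma Ck_on_cross_vel:
  assumes "open A" "Ck_on (Suc k) S A" "Ck_on k \<mu> A"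
  shows "Ck_on k (cross_vel m S \<mu>) A"
  unfolding cross_vel_def[abs_def] vel_v_def[abs_def]
  by (intro Ck_on_add Ck_on_bounded_linear[OF _ bounded_linear_scaleR_right] Ck_on_grad assms)

text \<open>Orthogonality of \<mu> and u, and of u and v, does not prevent \<mu> from having a
  component along v. Assuming \<mu> orthogonal to v removes the cross term, so the energy contains
  the full kinetic energy of \<omega>.\<close>

lemma energy_constant_on_streamline:
  assumes "hbar > 0" "m > 0" "open A" "negligible (- A)" "\<forall>x\<in>A. \<rho> x > 0"
    and "Ck_on 3 \<rho> A" "Ck_on 2 S A" "Ck_on 1 U A"
    and \<mu>: "\<mu> \<in> nowork_cross_flows A hbar m \<rho> S U"
    and "AE x in lebesgue. \<mu> x \<bullet> vel_v m S x = 0"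
    and "streamline A (cross_vel m S \<mu>) \<gamma> I"
  shows "(\<lambda>x. energy_density hbar m \<rho> S U (vel_u hbar m \<rho>) x / \<rho> x) constant_on (\<gamma> ` I)"
proof -
  let ?w = "cross_vel m S \<mu>" and ?P = "pressure hbar m \<rho>"
  have A: "AE x in lebesgue. x \<in> A"
    using assms(4) by (simp add: AE_lebesgue_iff_negligible Compl_eq)
  obtain F where F: "nowork_force ?w F" "momentum_equation hbar m \<rho> U ?w F"
    and cf: "cross_flow A hbar m \<rho> \<mu>" and sm: "smooth_flow \<rho> S"
    using \<mu> by (auto simp: nowork_cross_flows_def)
  have C\<rho>: "Ck_on 2 \<rho> A" "Ck_on 1 \<rho> A"
    using Ck_on_SucD[of 2 \<rho> A] Ck_on_SucD[of 1 \<rho> A] assms(6) by (simp_all add: numeral_3_eq_3 numeral_2_eq_2)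
  have C\<mu>: "Ck_on 1 \<mu> A"
    using cf by (simp add: cross_flow_def)
  have Cw: "Ck_on 1 ?w A"
    using Ck_on_cross_vel[OF assms(3), of 1] assms(7) C\<mu> by (simp add: numeral_2_eq_2)
  \<comment> \<open>The pressure contains second derivatives of \<rho>, so order three of \<rho>
    gives it the continuous gradient needed below.\<close>
  have "Ck_on 1 (laplacian \<rho>) A"
    using Ck_on_laplacian[OF assms(3), of 1] assms(6) by (simp add: numeral_3_eq_3)
  then have "Ck_on 1 (\<lambda>x. - (hbar\<^sup>2 / (4 * m)) * laplacian \<rho> x) A"
    by (rule Ck_on_bounded_linear[OF assms(3) bounded_linear_mult_right])
  then have CP: "Ck_on 1 ?P A"
    by (subst Ck_on_cong[OF assms(3)]) (rule pressure_eq_laplacian[OF assms(3) _ C\<rho>(1) assms(5)])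
  have cont: "continuous_on A f" if "Ck_on 1 f A" for f :: "real^3 \<Rightarrow> 'b::real_normed_vector"
    using that Ck_on_imp_continuous_on by blast
  have cont_grad: "continuous_on A (grad f)" if "Ck_on 1 f A" for f
    using Ck_on_grad[OF assms(3), of 0] that by simp
  have cv: "continuous_on A (vel_v m S)"
    unfolding vel_v_def[abs_def] using assms(7) Ck_on_SucD[of 1 S A]
    by (intro continuous_intros cont_grad) (simp add: numeral_2_eq_2)
  have diff: "f differentiable (at x)" if "Ck_on 1 f A" "x \<in> A" for f :: "real^3 \<Rightarrow> 'b::real_normed_vector" and x
    using Ck_on_Suc_differentiable[of 0] that assms(3) by simp
  have orth: "\<mu> x \<bullet> vel_v m S x = 0" if "x \<in> A" for x
    by (rule AE_eq_continuous_imp_eq[OF assms(3) _ _ assms(10) that])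
      (intro continuous_intros cont C\<mu> cv)+
  have sq: "?w x \<bullet> ?w x = (norm (vel_u hbar m \<rho> x))\<^sup>2 + (norm (vel_v m S x))\<^sup>2" if "x \<in> A" for x
    using orth[OF that] cross_flow_norm_eq[OF assms(3,5) C\<rho>(2) cf that]
    by (simp add: cross_vel_def inner_add_left inner_add_right inner_commute power2_norm_eq_inner)
      (metis power2_norm_eq_inner)
  \<comment> \<open>On \<open>A\<close> the field u is a nonzero multiple of
    \<open>grad \<rho>\<close>, so \<mu> is orthogonal to it almost everywhere, and v is by
    smoothness; continuity then covers every point.\<close>
  have \<rho>w: "grad \<rho> x \<bullet> ?w x = 0" if "x \<in> A" for x
  proof (rule AE_eq_continuous_imp_eq[OF assms(3) _ _ _ that])
    show "continuous_on A (\<lambda>x. grad \<rho> x \<bullet> ?w x)"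
      by (intro continuous_intros cont cont_grad Cw C\<rho>)
    have "AE x in lebesgue. \<mu> x \<bullet> vel_u hbar m \<rho> x = 0"
      using cf by (simp add: cross_flow_def)
    with A sm[unfolded smooth_flow_def] show "AE x in lebesgue. grad \<rho> x \<bullet> ?w x = 0"
    proof eventually_elim
      case (elim x)
      then have "\<mu> x \<bullet> grad \<rho> x = 0"
        using assms(1,2,5) by (auto simp: vel_u_def)
      then show ?case
        using elim by (simp add: cross_vel_def vel_v_def inner_add_right inner_commute)
    qed
  qed simp
  \<comment> \<open>Taking the inner product with \<omega> eliminates \<open>F\<close>, which need
    not be continuous; the remaining expression is, so the identity extends to all of
    \<open>A\<close>.\<close>
  have work: "?w x \<bullet> ((m * \<rho> x) *\<^sub>R material_deriv ?w x + grad ?P x + \<rho> x *\<^sub>R grad U x) = 0"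
    if "x \<in> A" for x
  proof (rule AE_eq_continuous_imp_eq[OF assms(3) _ _ _ that])
    show "continuous_on A (\<lambda>x. ?w x \<bullet> ((m * \<rho> x) *\<^sub>R material_deriv ?w x + grad ?P x + \<rho> x *\<^sub>R grad U x))"
      by (intro continuous_intros cont cont_grad continuous_on_material_deriv Cw C\<rho> CP assms)
    show "AE x in lebesgue. ?w x \<bullet> ((m * \<rho> x) *\<^sub>R material_deriv ?w x + grad ?P x + \<rho> x *\<^sub>R grad U x) = 0"
      using F unfolding nowork_force_def momentum_equation_def mass_density_def
      by eventually_elim (simp add: inner_commute)
  qed simp
  have "\<exists>D. ((\<lambda>x. energy_density hbar m \<rho> S U (vel_u hbar m \<rho>) x / \<rho> x) has_derivative D) (at x) \<and> D (?w x) = 0"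
    if x: "x \<in> A" for x
  proof (rule bernoulli_derivative[OF assms(3) x _ diff[OF Cw x] diff[OF CP x] diff[OF C\<rho>(2) x]
        diff[OF assms(8) x] _ work[OF x] \<rho>w[OF x]])
    show "energy_density hbar m \<rho> S U (vel_u hbar m \<rho>) y / \<rho> y = m / 2 * (?w y \<bullet> ?w y) + ?P y / \<rho> y + U y"
      if "y \<in> A" for y
      using that assms(5) by (simp add: sq energy_density_def mass_density_def field_simps less_le)
  qed (use assms(5) x in auto)
  then show ?thesis
    by (rule constant_on_streamline[OF assms(11)])
qed

text \<open>Where \<open>\<omega>\<close> vanishes, equality of the two momentum densities says nothing pointwise; but by
  continuity a nonzero divergence would force \<open>\<omega> = 0\<close> on a neighbourhood, hence zero divergence.\<close>

lemma momentum_time_deriv_eq_iff_mass_conserved: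
  assumes "open A" "negligible (- A)" "Ck_on 1 \<rho> A" "Ck_on 1 w A"
  shows "(AE x in lebesgue. mass_density m \<rho> x *\<^sub>R material_deriv w x = momentum_time_deriv m \<rho> w x)
    \<longleftrightarrow> (AE x in lebesgue. mass_flux_divergence m \<rho> w x = 0)"
proof
  let ?d = "mass_flux_divergence m \<rho> w"
  assume "AE x in lebesgue. mass_density m \<rho> x *\<^sub>R material_deriv w x = momentum_time_deriv m \<rho> w x"
  then have ae: "AE x in lebesgue. ?d x *\<^sub>R w x = 0"
    by eventually_elim (simp add: momentum_time_deriv_def)
  have "Ck_on 1 (\<lambda>y. mass_density m \<rho> y *\<^sub>R w y) A"
    unfolding mass_density_def
    by (intro Ck_on_bilinear[OF _ bounded_bilinear_scaleR]
        Ck_on_bounded_linear[OF _ bounded_linear_mult_right] assms)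
  then have cd: "continuous_on A ?d"
    unfolding mass_flux_divergence_def[abs_def]
    using Ck_on_divergence[OF assms(1), of 0] by simp
  have zero: "?d x *\<^sub>R w x = 0" if "x \<in> A" for x
    by (rule AE_eq_continuous_imp_eq[OF assms(1) _ _ ae that])
      (intro continuous_intros cd Ck_on_imp_continuous_on[OF assms(4)])+
  have "?d x = 0" if "x \<in> A" for x
  proof (rule ccontr)
    assume "?d x \<noteq> 0"
    let ?B = "A \<inter> ?d -` (- {0})"
    have B: "open ?B" "x \<in> ?B"
      using that \<open>?d x \<noteq> 0\<close> by (auto intro!: continuous_open_preimage cd assms(1))
    have "?d x = divergence (\<lambda>y. 0) x"
      unfolding mass_flux_divergence_def
      by (rule divergence_cong_open[OF B]) (use zero in auto)
    also have "\<dots> = 0"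
      by (simp add: divergence_def partial_deriv_eqI[OF has_derivative_const])
    finally show False
      using \<open>?d x \<noteq> 0\<close> by simp
  qed
  moreover have "AE x in lebesgue. x \<in> A"
    using assms(2) by (simp add: AE_lebesgue_iff_negligible Compl_eq)
  ultimately show "AE x in lebesgue. ?d x = 0"
    by (auto elim: eventually_mono)
next
  assume "AE x in lebesgue. mass_flux_divergence m \<rho> w x = 0"
  then show "AE x in lebesgue. mass_density m \<rho> x *\<^sub>R material_deriv w x = momentum_time_deriv m \<rho> w x"
    by eventually_elim (simp add: momentum_time_deriv_def)
qed

text \<open>One field E is fixed before the cross flows are quantified, so it is common to all of
  them. Constancy on streamlines is stated for \<mu> orthogonal to v, the condition under which
  \<omega> has squared norm equal to that of u plus that of v.\<close>

theorem theorem9: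
  fixes hbar m :: real
    and \<rho> S U :: "real^3 \<Rightarrow> real"
    and \<Omega> :: "(real^3) set"
  assumes "hbar > 0" and "m > 0"
    and "\<forall>x. \<rho> x \<ge> 0" and "negligible {x. \<rho> x = 0}"
    and "open \<Omega>" and "negligible (- \<Omega>)" and "\<forall>x\<in>\<Omega>. \<rho> x > 0"
    and "Ck_on 3 \<rho> \<Omega>" and "Ck_on 2 S \<Omega>" and "Ck_on 1 U \<Omega>"
    and "smooth_flow \<rho> S"
    and "nowork_cross_flows \<Omega> hbar m \<rho> S U \<noteq> {}"
  shows "\<exists>E :: real^3 \<Rightarrow> real.
     (\<forall>x\<in>\<Omega>. E x * \<rho> x = energy_density hbar m \<rho> S U (vel_u hbar m \<rho>) x) \<and>
     (\<forall>\<mu>\<in>nowork_cross_flows \<Omega> hbar m \<rho> S U.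
        (\<forall>x\<in>\<Omega>. E x * \<rho> x = energy_density hbar m \<rho> S U \<mu> x) \<and>
        ((AE x in lebesgue. \<mu> x \<bullet> vel_v m S x = 0) \<longrightarrow>
          (\<forall>\<gamma> I. streamline \<Omega> (cross_vel m S \<mu>) \<gamma> I \<longrightarrow> E constant_on (\<gamma> ` I)))) \<and>
     (continuity_equation m \<rho> S \<longrightarrow>
        ((\<exists>e. eigenpair (hamiltonian hbar m U) e (wavefunction hbar \<rho> S)) \<longleftrightarrow>
         (\<exists>c. AE x in lebesgue. E x = c)) \<and>
        (\<forall>e. eigenpair (hamiltonian hbar m U) e (wavefunction hbar \<rho> S) \<longrightarrow>
          (AE x in lebesgue. complex_of_real (E x) = e))) \<and>
     (\<forall>\<mu>\<in>nowork_cross_flows \<Omega> hbar m \<rho> S U.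
        (AE x in lebesgue. mass_density m \<rho> x *\<^sub>R material_deriv (cross_vel m S \<mu>) x
            = momentum_time_deriv m \<rho> (cross_vel m S \<mu>) x) \<longleftrightarrow>
        (AE x in lebesgue. mass_flux_divergence m \<rho> (cross_vel m S \<mu>) x = 0))"
proof -
  let ?u = "vel_u hbar m \<rho>"
  \<comment> \<open>The witness is built from u alone; equality of the norms of \<mu> and u carries
    it to each cross flow. A vanishing \<rho>, where division defaults to 0, can occur only off
    \<Omega>.\<close>
  let ?E = "\<lambda>x. energy_density hbar m \<rho> S U ?u x / \<rho> x"
  note pos = \<open>\<forall>x\<in>\<Omega>. \<rho> x > 0\<close>
  have C2: "Ck_on 2 \<rho> \<Omega>"
    using \<open>Ck_on 3 \<rho> \<Omega>\<close> Ck_on_SucD[of 2 \<rho> \<Omega>] by (simp add: numeral_3_eq_3 numeral_2_eq_2)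
  then have C1: "Ck_on 1 \<rho> \<Omega>"
    using Ck_on_SucD[of 1 \<rho> \<Omega>] by (simp add: numeral_2_eq_2)
  have cf: "cross_flow \<Omega> hbar m \<rho> \<mu>" if "\<mu> \<in> nowork_cross_flows \<Omega> hbar m \<rho> S U" for \<mu>
    using that by (simp add: nowork_cross_flows_def)
  have Cw: "Ck_on 1 (cross_vel m S \<mu>) \<Omega>" if "\<mu> \<in> nowork_cross_flows \<Omega> hbar m \<rho> S U" for \<mu>
    using Ck_on_cross_vel[OF \<open>open \<Omega>\<close>, of 1 S] \<open>Ck_on 2 S \<Omega>\<close> cf[OF that]
    by (simp add: numeral_2_eq_2 cross_flow_def)
  have energy: "\<forall>x\<in>\<Omega>. ?E x * \<rho> x = energy_density hbar m \<rho> S U ?u x"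
    using pos by (simp add: less_le)
  have cross_energy: "\<forall>x\<in>\<Omega>. ?E x * \<rho> x = energy_density hbar m \<rho> S U \<mu> x"
    if "\<mu> \<in> nowork_cross_flows \<Omega> hbar m \<rho> S U" for \<mu>
    using energy cross_flow_norm_eq[OF \<open>open \<Omega>\<close> pos C1 cf[OF that]]
    by (simp add: energy_density_def)
  have eigen: "((\<exists>e. eigenpair (hamiltonian hbar m U) e (wavefunction hbar \<rho> S)) \<longleftrightarrow>
         (\<exists>c. AE x in lebesgue. ?E x = c)) \<and>
        (\<forall>e. eigenpair (hamiltonian hbar m U) e (wavefunction hbar \<rho> S) \<longrightarrow>
          (AE x in lebesgue. complex_of_real (?E x) = e))" if "continuity_equation m \<rho> S"
  proof -
    note iff = eigenpair_wavefunction_iff[OF \<open>open \<Omega>\<close> \<open>negligible (- \<Omega>)\<close> pos C2 \<open>Ck_on 2 S \<Omega>\<close>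
        \<open>hbar > 0\<close> \<open>m > 0\<close> \<open>smooth_flow \<rho> S\<close> that]
    \<comment> \<open>Eigenvalues range over the complex numbers while E is real, so the uniform
      value is the real part of \<open>e\<close>.\<close>
    have "AE x in lebesgue. ?E x = Re e" if "AE x in lebesgue. complex_of_real (?E x) = e" for e
      using that by eventually_elim (metis Re_complex_of_real)
    moreover have "AE x in lebesgue. complex_of_real (?E x) = of_real c" if "AE x in lebesgue. ?E x = c" for c
      using that by eventually_elim (rule arg_cong)
    ultimately show ?thesis
      unfolding iff by blast
  qed
  show ?thesis
  proof (rule exI[of _ ?E], intro conjI ballI impI allI)
    show "?E x * \<rho> x = energy_density hbar m \<rho> S U ?u x" if "x \<in> \<Omega>" for x
      using energy that by blast
    show "?E x * \<rho> x = energy_density hbar m \<rho> S U \<mu> x"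
      if "\<mu> \<in> nowork_cross_flows \<Omega> hbar m \<rho> S U" "x \<in> \<Omega>" for \<mu> x
      using cross_energy that by blast
    show "?E constant_on (\<gamma> ` I)"
      if "\<mu> \<in> nowork_cross_flows \<Omega> hbar m \<rho> S U" "AE x in lebesgue. \<mu> x \<bullet> vel_v m S x = 0"
        "streamline \<Omega> (cross_vel m S \<mu>) \<gamma> I" for \<mu> \<gamma> I
      using assms that by (intro energy_constant_on_streamline)
    show "(AE x in lebesgue. mass_density m \<rho> x *\<^sub>R material_deriv (cross_vel m S \<mu>) x
            = momentum_time_deriv m \<rho> (cross_vel m S \<mu>) x) \<longleftrightarrow>
        (AE x in lebesgue. mass_flux_divergence m \<rho> (cross_vel m S \<mu>) x = 0)"
      if "\<mu> \<in> nowork_cross_flows \<Omega> hbar m \<rho> S U" for \<mu>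
      by (rule momentum_time_deriv_eq_iff_mass_conserved[OF \<open>open \<Omega>\<close> \<open>negligible (- \<Omega>)\<close> C1 Cw[OF that]])
  qed (use eigen in blast)+
qed

end
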